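(* Let $\mathcal{A}$ be an $n\times n$ sign pattern. If all the off-diagonal entries of $\mathcal{A}$ are nonzero, then $\mathcal{A}$ requires the nSMP.
   Context: A real $n\times n$ matrix $A$ has the non-symmetric strong multiplicity property (nSMP) if the only real $n\times n$ matrix $X$ satisfying all of (1) $A\circ X=O$ (entrywise product), (2) $AX^T-X^TA=O$, and (3) $\mathrm{tr}(X^TA^k)=0$ for all $0\le k<n$, is $X=O$ (the zero matrix). A sign pattern is an $n\times n$ matrix $\mathcal{A}$ with entries in $\{+,-,0\}$; $Q(\mathcal{A})$ is the set of real $n\times n$ matrices $A$ with $A_{ij}>0$ if $\mathcal{A}_{ij}=+$, $A_{ij}<0$ if $\mathcal{A}_{ij}=-$, and $A_{ij}=0$ if $\mathcal{A}_{ij}=0$. The pattern $\mathcal{A}$ requires a property if every $A\in Q(\mathcal{A})$ has the property. *)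

theory Defs
  imports "HOL-Analysis.Analysis"
begin

text \<open>
  The operations * and ^ on the type of vectors and matrices act entrywise: * is the
  entrywise product used below, but ^ is not the power of a matrix, and so
  the power is defined here from the matrix product.
\<close>

primrec matrix_power :: "real ^ 'n ^ 'n \<Rightarrow> nat \<Rightarrow> real ^ 'n ^ 'n" where
  "matrix_power A 0 = mat 1"
| "matrix_power A (Suc k) = A ** matrix_power A k"

definition nSMP :: "real ^ 'n ^ 'n \<Rightarrow> bool" where
  "nSMP A \<longleftrightarrow>
     (\<forall>X :: real ^ 'n ^ 'n.
        A * X = 0 \<and>
        A ** transpose X - transpose X ** A = 0 \<and>
        (\<forall>k < CARD('n). trace (transpose X ** matrix_power A k) = 0)
        \<longrightarrow> X = 0)"

datatype sign_entry = Plus | Minus | Zero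

type_synonym 'n sign_pattern = "sign_entry ^ 'n ^ 'n"

definition qualitative_class :: "'n::finite sign_pattern \<Rightarrow> (real ^ 'n ^ 'n) set" where
  "qualitative_class S =
     {A. \<forall>i j. (S $ i $ j = Plus \<longrightarrow> A $ i $ j > 0) \<and>
               (S $ i $ j = Minus \<longrightarrow> A $ i $ j < 0) \<and>
               (S $ i $ j = Zero \<longrightarrow> A $ i $ j = 0)}"

definition requires_property :: "'n::finite sign_pattern \<Rightarrow> (real ^ 'n ^ 'n \<Rightarrow> bool) \<Rightarrow> bool" where
  "requires_property S P \<longleftrightarrow> (\<forall>A \<in> qualitative_class S. P A)"

end

theory Submission
  imports Defs
begin

text \<open>
  Since \<open>A\<close> has no zero entry off the diagonal, \<open>A \<circ> X = 0\<close> makes \<open>X\<close> diagonal.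
  Commuting with \<open>A\<close> then forces the diagonal entries of \<open>X\<close> to agree, so \<open>X\<close> is scalar,
  and the trace condition for \<open>k = 0\<close> forces the scalar to be zero.
\<close>

lemma diag_matrix_mult_right:
  fixes A D :: "'a::semiring_1 ^ 'n ^ 'n"
  assumes "\<And>i j. i \<noteq> j \<Longrightarrow> D $ i $ j = 0"
  shows "(A ** D) $ i $ j = A $ i $ j * D $ j $ j"
proof -
  have "(\<Sum>k\<in>UNIV. A $ i $ k * D $ k $ j) = (\<Sum>k\<in>{j}. A $ i $ k * D $ k $ j)"
    by (rule sum.mono_neutral_right) (auto simp: assms)
  then show ?thesis by (simp add: matrix_matrix_mult_def)
qed

lemma diag_matrix_mult_left:
  fixes A D :: "'a::semiring_1 ^ 'n ^ 'n"
  assumes "\<And>i j. i \<noteq> j \<Longrightarrow> D $ i $ j = 0"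
  shows "(D ** A) $ i $ j = D $ i $ i * A $ i $ j"
proof -
  have "(\<Sum>k\<in>UNIV. D $ i $ k * A $ k $ j) = (\<Sum>k\<in>{i}. D $ i $ k * A $ k $ j)"
    by (rule sum.mono_neutral_right) (auto simp: assms)
  then show ?thesis by (simp add: matrix_matrix_mult_def)
qed

lemma nSMP_if_offdiag_nonzero:
  fixes A :: "real ^ 'n ^ 'n"
  assumes nz: "\<And>i j. i \<noteq> j \<Longrightarrow> A $ i $ j \<noteq> 0"
  shows "nSMP A"
  unfolding nSMP_def
proof (intro allI impI, elim conjE)
  fix X :: "real ^ 'n ^ 'n"
  assume had: "A * X = 0"
    and comm: "A ** transpose X - transpose X ** A = 0"
    and tr: "\<forall>k < CARD('n). trace (transpose X ** matrix_power A k) = 0"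
  have "A $ i $ j * X $ i $ j = 0" for i j
    using arg_cong[OF had, of "\<lambda>M. M $ i $ j"] by simp
  then have offdiag: "X $ i $ j = 0" if "i \<noteq> j" for i j
    using nz[OF that] mult_eq_0_iff by blast
  then have diag_t: "transpose X $ i $ j = 0" if "i \<noteq> j" for i j
    using that by (simp add: transpose_def)
  have eq: "X $ i $ i = X $ j $ j" for i j
  proof (cases "i = j")
    case False
    \<comment> \<open>A diagonal right factor scales columns and a left one scales rows, so the two
      sides differ only in which diagonal entry of \<open>X\<close> multiplies
      \<open>A $ i $ j\<close>, and this nonzero factor cancels.\<close>
    have "(A ** transpose X) $ i $ j = (transpose X ** A) $ i $ j"
      using comm by simp
    then have "A $ i $ j * X $ j $ j = X $ i $ i * A $ i $ j"
      \<comment> \<open>The transpose stays folded until both products are rewritten, since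
        \<open>diag_t\<close> speaks of \<open>transpose X\<close>.\<close>
      by (simp add: diag_matrix_mult_right[OF diag_t] diag_matrix_mult_left[OF diag_t])
         (simp add: transpose_def)
    then show ?thesis using nz[OF False] by simp
  qed simp
  \<comment> \<open>The exponent 0 is admissible because \<open>CARD('n)\<close> is positive;
    keeping the power folded lets \<open>tr\<close> match.\<close>
  have "trace (transpose X ** matrix_power A 0) = 0"
    using tr by (simp del: matrix_power.simps)
  then have "(\<Sum>j\<in>UNIV. X $ j $ j) = 0"
    by (simp add: trace_def transpose_def)
  \<comment> \<open>The vanishing trace is thus \<open>CARD('n)\<close> times any one diagonal
    entry, and \<open>CARD('n)\<close> is nonzero in the reals.\<close>
  moreover have "(\<Sum>j\<in>UNIV. X $ j $ j) = (\<Sum>j\<in>(UNIV :: 'n set). X $ i $ i)" for i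
    by (rule sum.cong[OF refl eq])
  ultimately have "X $ i $ i = 0" for i
    by simp
  with offdiag have "X $ i $ j = 0" for i j
    by (cases "i = j") auto
  then show "X = 0" by (simp add: vec_eq_iff)
qed

theorem theorem3p2:
  fixes S :: "'n::finite sign_pattern"
  assumes "\<And>i j. i \<noteq> j \<Longrightarrow> S $ i $ j \<noteq> Zero"
  shows "requires_property S nSMP"
  unfolding requires_property_def
proof
  fix A assume A: "A \<in> qualitative_class S"
  show "nSMP A"
  proof (rule nSMP_if_offdiag_nonzero)
    fix i j :: 'n assume "i \<noteq> j"
    with A assms[of i j] show "A $ i $ j \<noteq> 0"
      \<comment> \<open>\<open>less_le\<close> extracts the disequality from either strict sign
        condition.\<close>
      by (cases "S $ i $ j") (auto simp: qualitative_class_def less_le)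
  qed
qed

end
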